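(* If $\partial f^*$ and $\partial g^*$ are polyhedral multifunctions, then the following error bound holds: for any $\nu_1>0$ there exists $\zeta_1>0$ such that $$\operatorname{dist}(w,\mathcal S^{-1}(0))\le\zeta_1\operatorname{dist}(0,\mathcal S(w))\quad\text{whenever}\quad\operatorname{dist}(w,\mathcal S^{-1}(0))\le\nu_1,$$ where $\mathcal S$ is the multifunction defined in the context.
   Context: $f:\mathbb R^n\to(-\infty,\infty]$ and $g:\mathbb R^m\to(-\infty,\infty]$ are proper, closed, convex, with Fenchel conjugates $f^*,g^*$; $A:\mathbb R^n\to\mathbb R^m$ and $B:\mathbb R^n\to\mathbb R^p$ are linear; $Qx:=[Ax;Bx]\in\mathbb R^{m+p}$. Vectors of $\mathbb R^{m+p}$ are written $w=[y;z]$ with $y\in\mathbb R^m$, $z\in\mathbb R^p$. $T_\infty\subseteq\{1,\dots,p\}$ is a fixed index set with complement $\overline T_\infty$, and $\mathcal V_\infty=\{v\in\mathbb R^p:v_{T_\infty}=0\}$, where $v_T$ denotes the subvector indexed by $T$. For $w=[y;z]$ with $z_{\overline T_\infty}=0$, $$\mathcal S(w)=\{-Q\xi+[u;v]:\ \xi\in\partial f^*(-Q^\top w),\ u\in\partial g^*(y),\ v\in\mathcal V_\infty\},$$ and $\mathcal S(w)=\emptyset$ if $z_{\overline T_\infty}\neq0$. $\mathcal S^{-1}(0)=\{w:0\in\mathcal S(w)\}$. $\operatorname{dist}(w,\Omega)=\inf_{u\in\Omega}\|w-u\|$, equal to $+\infty$ if $\Omega=\emptyset$. A multifunction is polyhedral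 if its graph is a union of finitely many polyhedral convex sets. *)

theory Defs
  imports "HOL-Analysis.Analysis"
begin

definition ereal_epigraph :: "('a \<Rightarrow> ereal) \<Rightarrow> ('a \<times> real) set" where
  "ereal_epigraph h = {(x, r). h x \<le> ereal r}"

definition proper_fun :: "('a \<Rightarrow> ereal) \<Rightarrow> bool" where
  "proper_fun h \<longleftrightarrow> (\<forall>x. h x \<noteq> -\<infinity>) \<and> (\<exists>x. h x \<noteq> \<infinity>)"

definition closed_fun :: "('a::euclidean_space \<Rightarrow> ereal) \<Rightarrow> bool" where
  "closed_fun h \<longleftrightarrow> closed (ereal_epigraph h)"

definition convex_fun :: "('a::euclidean_space \<Rightarrow> ereal) \<Rightarrow> bool" where
  "convex_fun h \<longleftrightarrow> convex (ereal_epigraph h)"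

definition fenchel_conjugate :: "('a::euclidean_space \<Rightarrow> ereal) \<Rightarrow> 'a \<Rightarrow> ereal" where
  "fenchel_conjugate h s = (SUP x. ereal (s \<bullet> x) - h x)"

text \<open>For proper \<open>h\<close> this set is empty wherever \<open>h x = \<infinity>\<close>.\<close>

definition subdifferential :: "('a::euclidean_space \<Rightarrow> ereal) \<Rightarrow> 'a \<Rightarrow> 'a set" where
  "subdifferential h x = {s. \<forall>y. h x + ereal (s \<bullet> (y - x)) \<le> h y}"

text \<open>A multifunction from \<open>'a\<close> to \<open>'b\<close> is a function \<open>'a \<Rightarrow> 'b set\<close>.\<close>

definition graph_of :: "('a \<Rightarrow> 'b set) \<Rightarrow> ('a \<times> 'b) set" where
  "graph_of F = {(x, y). y \<in> F x}"

definition multi_inverse :: "('a \<Rightarrow> 'b set) \<Rightarrow> 'b \<Rightarrow> 'a set" where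
  "multi_inverse F y = {x. y \<in> F x}"

definition polyhedral_multifunction ::
    "('a::euclidean_space \<Rightarrow> 'b::euclidean_space set) \<Rightarrow> bool" where
  "polyhedral_multifunction F \<longleftrightarrow>
     (\<exists>\<C>. finite \<C> \<and> (\<forall>C\<in>\<C>. polyhedron C) \<and> graph_of F = \<Union>\<C>)"

text \<open>Unlike \<^const>\<open>infdist\<close>, which is \<open>0\<close> on the empty set, this distance is \<open>\<infinity>\<close> there.\<close>

definition ext_dist :: "'a::metric_space \<Rightarrow> 'a set \<Rightarrow> ereal" where
  "ext_dist w \<Omega> = (INF u\<in>\<Omega>. ereal (dist w u))"

text \<open>
  The space $R^{m+p}$ is rendered as the product type \<open>(real^'m) \<times> (real^'p)\<close>, whose library norm
  and inner product are the Euclidean ones; the stacked vector \<open>[y;z]\<close> is the pair \<open>(y, z)\<close>.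
\<close>

definition stacked_map ::
    "(real^'n \<Rightarrow> real^'m) \<Rightarrow> (real^'n \<Rightarrow> real^'p) \<Rightarrow> real^'n \<Rightarrow> (real^'m) \<times> (real^'p)" where
  "stacked_map A B x = (A x, B x)"

definition V_inf :: "'p set \<Rightarrow> (real^'p) set" where
  "V_inf T = {v. \<forall>i\<in>T. v $ i = 0}"

definition S_map ::
    "(real^'n \<Rightarrow> ereal) \<Rightarrow> (real^'m \<Rightarrow> ereal) \<Rightarrow> (real^'n \<Rightarrow> real^'m) \<Rightarrow> (real^'n \<Rightarrow> real^'p) \<Rightarrow>
     'p set \<Rightarrow> (real^'m) \<times> (real^'p) \<Rightarrow> ((real^'m) \<times> (real^'p)) set" where
  "S_map f g A B T w =
     (if \<forall>i\<in>- T. snd w $ i = 0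
      then {- stacked_map A B \<xi> + (u, v) | \<xi> u v.
              \<xi> \<in> subdifferential (fenchel_conjugate f) (- adjoint (stacked_map A B) w) \<and>
              u \<in> subdifferential (fenchel_conjugate g) (fst w) \<and>
              v \<in> V_inf T}
      else {})"

end

theory Submission
  imports Defs
begin

text \<open>
  The graph of \<open>\<S>\<close> is a finite union of linear images of polyhedra of tuples \<open>(w, \<xi>, u, v)\<close>, on
  which the residual \<open>- Q \<xi> + (u, v)\<close> is linear. A Hoffman-type bound on each of these polyhedra,
  valid for small residuals even where the residual never vanishes, shows that \<open>w\<close> is at distance
  at most \<open>\<kappa> * norm e\<close> from the solution set if \<open>e \<in> \<S> w\<close> and \<open>norm e \<le> \<epsilon>\<close>. If \<open>norm e > \<epsilon>\<close>, the
  assumed bound \<open>\<nu>\<close> on the distance is at most \<open>\<nu> / \<epsilon> * norm e\<close>.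
\<close>

section \<open>Polyhedra as solution sets of finite linear systems\<close>

lemma polyhedron_halfspaces_obtain:
  fixes P :: "'a::euclidean_space set"
  assumes "polyhedron P"
  obtains F where "finite F" "P = {x. \<forall>(c, \<beta>)\<in>F. c \<bullet> x \<le> \<beta>}"
proof -
  obtain H where H: "finite H" "P = \<Inter>H" "\<forall>h\<in>H. \<exists>c \<beta>. c \<noteq> 0 \<and> h = {x. c \<bullet> x \<le> \<beta>}"
    using assms unfolding polyhedron_def by (elim exE conjE)
  then obtain c \<beta> where c: "\<forall>h\<in>H. h = {x. c h \<bullet> x \<le> \<beta> h}"
    by metis
  have "P = {x. \<forall>(c, \<beta>)\<in>(\<lambda>h. (c h, \<beta> h)) ` H. c \<bullet> x \<le> \<beta>}"
    using H(2) c by fastforce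
  then show thesis
    using H(1) that[of "(\<lambda>h. (c h, \<beta> h)) ` H"] by simp
qed

text \<open>Zero normals are allowed in \<open>F\<close>: such a constraint describes the whole
  space or the empty set, both of which are polyhedra. Linear preimages can produce them.\<close>

lemma polyhedron_halfspaces:
  fixes F :: "('a::euclidean_space \<times> real) set"
  assumes "finite F"
  shows "polyhedron {x. \<forall>(c, \<beta>)\<in>F. c \<bullet> x \<le> \<beta>}"
proof -
  have "{x. \<forall>(c, \<beta>)\<in>F. c \<bullet> x \<le> \<beta>} = \<Inter>((\<lambda>(c, \<beta>). {x. c \<bullet> x \<le> \<beta>}) ` F)"
    by auto
  then show ?thesis
    using assms by (auto intro!: polyhedron_Inter polyhedron_halfspace_le)
qed

text \<open>Since \<open>c \<bullet> h x = adjoint h c \<bullet> x\<close>, a preimage satisfies the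
  same system with each normal \<open>c\<close> replaced by \<open>adjoint h c\<close>, which may be
  zero.\<close>

lemma polyhedron_linear_vimage:
  fixes h :: "'a::euclidean_space \<Rightarrow> 'b::euclidean_space"
  assumes "linear h" "polyhedron P"
  shows "polyhedron (h -` P)"
proof -
  obtain F where F: "finite F" "P = {x. \<forall>(c, \<beta>)\<in>F. c \<bullet> x \<le> \<beta>}"
    using polyhedron_halfspaces_obtain[OF assms(2)] .
  have "h -` P = {x. \<forall>(c, \<beta>)\<in>(\<lambda>(c, \<beta>). (adjoint h c, \<beta>)) ` F. c \<bullet> x \<le> \<beta>}"
    unfolding F(2) by (auto simp: adjoint_clauses(2)[OF assms(1)] split: prod.splits)
  also have "polyhedron \<dots>"
    using F(1) by (intro polyhedron_halfspaces finite_imageI)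
  finally show ?thesis .
qed

section \<open>Error bounds of Hoffman type for polyhedra\<close>

text \<open>The constant is uniform because only finitely many sets \<open>I\<close> of active constraints occur.\<close>

lemma uniform_descent_rate:
  fixes F :: "('a::euclidean_space \<times> real) set"
  assumes "finite F"
  obtains c where "c > 0"
    "\<And>I. \<lbrakk>I \<subseteq> F; \<exists>d. (\<forall>i\<in>I. fst i \<bullet> d \<le> 0) \<and> a \<bullet> d < 0\<rbrakk>
      \<Longrightarrow> \<exists>d. (\<forall>i\<in>I. fst i \<bullet> d \<le> 0) \<and> a \<bullet> d < 0 \<and> c * norm d \<le> - (a \<bullet> d)"
proof -
  define Q where "Q I d \<longleftrightarrow> (\<forall>i\<in>I. fst i \<bullet> d \<le> 0) \<and> a \<bullet> d < 0" for I :: "('a \<times> real) set" and d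
  define J where "J = {I \<in> Pow F. \<exists>d. Q I d}"
  have J: "finite J"
    using assms by (simp add: J_def)
  obtain D where D: "\<forall>I\<in>J. Q I (D I)"
    using finite_set_choice[OF J, of Q] by (auto simp: J_def)
  \<comment> \<open>The least rate over the chosen directions; the inserted \<open>1\<close> keeps
    the minimum defined and positive when \<open>J\<close> is empty.\<close>
  define c where "c = Min (insert 1 ((\<lambda>I. - (a \<bullet> D I) / norm (D I)) ` J))"
  have pos: "norm (D I) > 0" "a \<bullet> D I < 0" if "I \<in> J" for I
    using D that by (auto simp: Q_def)
  have "c > 0"
    unfolding c_def using J pos by (subst Min_gr_iff) (auto intro: divide_pos_pos simp: divide_less_0_iff)
  moreover have "\<exists>d. Q I d \<and> c * norm d \<le> - (a \<bullet> d)" if "I \<subseteq> F" "\<exists>d. Q I d" for I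
  proof -
    have I: "I \<in> J" using that by (auto simp: J_def)
    have "c \<le> - (a \<bullet> D I) / norm (D I)"
      unfolding c_def using J I by (intro Min_le) auto
    then show ?thesis
      using D I pos(1)[OF I] by (metis pos_le_divide_eq)
  qed
  ultimately show thesis
    using that unfolding Q_def by (metis (no_types, lifting))
qed

text \<open>Ekeland's argument: let \<open>c\<close> be the uniform descent rate and let \<open>x'\<close> minimise
  \<open>a \<bullet> y + c / 2 * dist x y\<close> over the points \<open>y\<close> of the polyhedron with \<open>\<beta> \<le> a \<bullet> y\<close>. If
  \<open>\<beta> < a \<bullet> x'\<close>, no feasible direction at \<open>x'\<close> descends at rate \<open>c\<close>, hence none descends at all.\<close>

lemma polyhedron_descent:
  fixes P :: "'a::euclidean_space set"
  assumes "polyhedron P"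
  obtains c where "c > 0"
    "\<And>x \<beta>. \<lbrakk>x \<in> P; \<beta> \<le> a \<bullet> x\<rbrakk> \<Longrightarrow>
      \<exists>x'\<in>P. \<beta> \<le> a \<bullet> x' \<and> c * dist x x' \<le> a \<bullet> x - a \<bullet> x' \<and>
        (\<beta> < a \<bullet> x' \<longrightarrow> (\<forall>y\<in>P. a \<bullet> x' \<le> a \<bullet> y))"
proof -
  obtain F where F: "finite F" "P = {x. \<forall>(c, \<beta>)\<in>F. c \<bullet> x \<le> \<beta>}"
    using polyhedron_halfspaces_obtain[OF assms] .
  have inP: "x \<in> P \<longleftrightarrow> (\<forall>i\<in>F. fst i \<bullet> x \<le> snd i)" for x
    unfolding F(2) by auto
  obtain c where c: "c > 0"
    "\<And>I. \<lbrakk>I \<subseteq> F; \<exists>d. (\<forall>i\<in>I. fst i \<bullet> d \<le> 0) \<and> a \<bullet> d < 0\<rbrakk>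
      \<Longrightarrow> \<exists>d. (\<forall>i\<in>I. fst i \<bullet> d \<le> 0) \<and> a \<bullet> d < 0 \<and> c * norm d \<le> - (a \<bullet> d)"
    using uniform_descent_rate[OF F(1), of a] by blast
  have "\<exists>x'\<in>P. \<beta> \<le> a \<bullet> x' \<and> c / 2 * dist x x' \<le> a \<bullet> x - a \<bullet> x' \<and>
        (\<beta> < a \<bullet> x' \<longrightarrow> (\<forall>y\<in>P. a \<bullet> x' \<le> a \<bullet> y))" if x: "x \<in> P" "\<beta> \<le> a \<bullet> x" for x \<beta>
  proof -
    define \<phi> where "\<phi> y = a \<bullet> y + c / 2 * dist x y" for y
    define K where "K = P \<inter> {y. \<beta> \<le> a \<bullet> y}"
    \<comment> \<open>Beyond distance \<open>R\<close> from \<open>x\<close> the penalty outweighs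
      the largest drop \<open>a \<bullet> x - \<beta>\<close> possible on \<open>K\<close>, so a
      minimiser on the compact set \<open>K \<inter> cball x R\<close> is one on all of
      \<open>K\<close>.\<close>
    define R where "R = 2 * (a \<bullet> x - \<beta>) / c"
    have "R \<ge> 0" using x c by (simp add: R_def)
    have "compact (K \<inter> cball x R)"
      unfolding K_def using polyhedron_imp_closed[OF assms]
      by (intro closed_Int_compact closed_Int) (auto simp: closed_halfspace_ge)
    moreover have "x \<in> K \<inter> cball x R"
      using x \<open>R \<ge> 0\<close> by (simp add: K_def)
    moreover have "continuous_on (K \<inter> cball x R) \<phi>"
      unfolding \<phi>_def by (intro continuous_intros)
    ultimately obtain x' where x': "x' \<in> K \<inter> cball x R" "\<And>y. y \<in> K \<inter> cball x R \<Longrightarrow> \<phi> x' \<le> \<phi> y"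
      using continuous_attains_inf[of "K \<inter> cball x R" \<phi>] by blast
    have le: "\<phi> x' \<le> \<phi> x" using x'(2) x \<open>R \<ge> 0\<close> by (simp add: K_def)
    have min: "\<phi> x' \<le> \<phi> y" if "y \<in> K" for y
    proof (cases "dist x y \<le> R")
      case True
      then show ?thesis using x'(2) that by simp
    next
      case False
      then have "a \<bullet> x - \<beta> \<le> c / 2 * dist x y"
        using c(1) by (simp add: R_def field_simps)
      then have "\<phi> x \<le> \<phi> y"
        using that by (simp add: \<phi>_def K_def)
      with le show ?thesis by simp
    qed
    have "\<forall>y\<in>P. a \<bullet> x' \<le> a \<bullet> y" if gt: "\<beta> < a \<bullet> x'"
    proof (rule ccontr)
      assume "\<not> ?thesis"
      then obtain y where y: "y \<in> P" "a \<bullet> y < a \<bullet> x'" by auto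
      \<comment> \<open>The active constraints at \<open>x'\<close>. The direction
        \<open>y - x'\<close> violates none of them and descends, so a direction \<open>d\<close> of
        rate \<open>c\<close> exists. Short steps along \<open>d\<close> stay in \<open>K\<close>:
        active constraints do not increase, and the inactive ones, like
        \<open>\<beta> < a \<bullet> x'\<close>, are strict and persist by continuity.\<close>
      define I where "I = {i\<in>F. fst i \<bullet> x' = snd i}"
      have "(\<forall>i\<in>I. fst i \<bullet> (y - x') \<le> 0) \<and> a \<bullet> (y - x') < 0"
        using y by (auto simp: I_def inP inner_diff_right)
      then obtain d where d: "\<forall>i\<in>I. fst i \<bullet> d \<le> 0" "a \<bullet> d < 0" "c * norm d \<le> - (a \<bullet> d)"
        using c(2)[of I] by (auto simp: I_def)
      have "\<forall>\<^sub>F t in at_right 0. fst i \<bullet> (x' + t *\<^sub>R d) \<le> snd i" if "i \<in> F" for i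
      proof (cases "i \<in> I")
        case True
        have "fst i \<bullet> (x' + t *\<^sub>R d) \<le> snd i" if "t > 0" for t
          using d(1) True that by (auto simp: I_def inner_add_right mult_nonneg_nonpos)
        then show ?thesis
          by (simp add: eventually_at_right_less eventually_mono[OF eventually_at_right_less])
      next
        case False
        then have lt: "fst i \<bullet> x' < snd i"
          using that x'(1) by (fastforce simp: I_def K_def inP)
        have "((\<lambda>t. fst i \<bullet> (x' + t *\<^sub>R d)) \<longlongrightarrow> fst i \<bullet> (x' + 0 *\<^sub>R d)) (at_right 0)"
          by (intro tendsto_intros)
        then have "\<forall>\<^sub>F t in at_right 0. fst i \<bullet> (x' + t *\<^sub>R d) < snd i"
          using lt by (intro order_tendstoD(2)) auto
        then show ?thesis by (rule eventually_mono) simp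
      qed
      then have "\<forall>\<^sub>F t in at_right 0. \<forall>i\<in>F. fst i \<bullet> (x' + t *\<^sub>R d) \<le> snd i"
        using F(1) by (simp add: eventually_ball_finite)
      moreover have "\<forall>\<^sub>F t in at_right 0. \<beta> < a \<bullet> (x' + t *\<^sub>R d)"
      proof -
        have "((\<lambda>t. a \<bullet> (x' + t *\<^sub>R d)) \<longlongrightarrow> a \<bullet> (x' + 0 *\<^sub>R d)) (at_right 0)"
          by (intro tendsto_intros)
        then show ?thesis using gt by (intro order_tendstoD(1)) auto
      qed
      moreover have "\<forall>\<^sub>F t in at_right (0::real). 0 < t"
        by (rule eventually_at_right_less)
      ultimately have "\<forall>\<^sub>F t in at_right 0. x' + t *\<^sub>R d \<in> K \<and> 0 < t"
        by eventually_elim (auto simp: K_def inP)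
      then obtain t where t: "x' + t *\<^sub>R d \<in> K" "0 < t"
        using eventually_happens[of _ "at_right (0::real)"] by auto
      \<comment> \<open>The penalty weight \<open>c / 2\<close> matters here: the penalty grows by
        at most half of what \<open>a\<close> loses along \<open>d\<close>, so \<open>\<phi>\<close>
        drops strictly, against the minimality of \<open>x'\<close>.\<close>
      have "dist x (x' + t *\<^sub>R d) \<le> dist x x' + t * norm d"
        using dist_triangle[of x "x' + t *\<^sub>R d" x'] t(2) by (simp add: dist_norm)
      then have "c / 2 * dist x (x' + t *\<^sub>R d) \<le> c / 2 * dist x x' + t * (c * norm d / 2)"
        using mult_left_mono[of _ _ "c / 2"] c(1) by (fastforce simp: algebra_simps)
      also have "\<dots> \<le> c / 2 * dist x x' + t * (- (a \<bullet> d) / 2)"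
        using d(3) t(2) by (intro add_left_mono mult_left_mono) auto
      finally have "\<phi> (x' + t *\<^sub>R d) \<le> \<phi> x' + t * (a \<bullet> d) / 2"
        by (simp add: \<phi>_def inner_add_right)
      moreover have "t * (a \<bullet> d) < 0"
        using d(2) t(2) by (simp add: mult_pos_neg)
      ultimately show False
        using min[OF t(1)] by simp
    qed
    then show ?thesis
      using x'(1) le by (intro bexI[of _ x']) (auto simp: K_def \<phi>_def)
  qed
  then show thesis
    using c(1) by (intro that[of "c / 2"]) auto
qed

text \<open>Descent from \<open>x\<close> ends either at level \<open>\<beta>\<close>, after a
  distance of at most \<open>r / c\<close>, or at a minimiser of \<open>a\<close> over
  \<open>P\<close> above that level. The latter happens only if \<open>P\<close> misses the
  half-space, and then a small \<open>\<epsilon>\<close> makes the claim vacuous.\<close>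

lemma polyhedron_Int_halfspace_error_bound:
  fixes P :: "'a::euclidean_space set"
  assumes "polyhedron P"
  obtains \<kappa> \<epsilon> where "\<kappa> > 0" "\<epsilon> > 0"
    "\<And>x r. \<lbrakk>x \<in> P; a \<bullet> x \<le> \<beta> + r; 0 \<le> r; r \<le> \<epsilon>\<rbrakk> \<Longrightarrow> \<exists>x'\<in>P. a \<bullet> x' \<le> \<beta> \<and> dist x x' \<le> \<kappa> * r"
proof -
  obtain c where c: "c > 0"
    "\<And>x \<beta>. \<lbrakk>x \<in> P; \<beta> \<le> a \<bullet> x\<rbrakk> \<Longrightarrow>
      \<exists>x'\<in>P. \<beta> \<le> a \<bullet> x' \<and> c * dist x x' \<le> a \<bullet> x - a \<bullet> x' \<and>
        (\<beta> < a \<bullet> x' \<longrightarrow> (\<forall>y\<in>P. a \<bullet> x' \<le> a \<bullet> y))"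
    using polyhedron_descent[OF assms, of a] by blast
  show thesis
  proof (cases "\<exists>y\<in>P. a \<bullet> y \<le> \<beta>")
    case True
    have "\<exists>x'\<in>P. a \<bullet> x' \<le> \<beta> \<and> dist x x' \<le> (1 / c) * r"
      if x: "x \<in> P" "a \<bullet> x \<le> \<beta> + r" "0 \<le> r" for x r
    proof (cases "a \<bullet> x \<le> \<beta>")
      case True
      then show ?thesis using x c(1) by (intro bexI[of _ x]) auto
    next
      case False
      then obtain x' where x': "x' \<in> P" "\<beta> \<le> a \<bullet> x'" "c * dist x x' \<le> a \<bullet> x - a \<bullet> x'"
        "\<beta> < a \<bullet> x' \<longrightarrow> (\<forall>y\<in>P. a \<bullet> x' \<le> a \<bullet> y)"
        using c(2)[of x \<beta>] x(1) by auto
      \<comment> \<open>\<open>True\<close> is the outer case: a point of \<open>P\<close> at level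
        at most \<open>\<beta>\<close> rules out a minimum above \<open>\<beta>\<close>.\<close>
      have "a \<bullet> x' \<le> \<beta>"
        using x'(4) True by force
      moreover have "c * dist x x' \<le> r"
        using x'(2,3) x(2) by simp
      ultimately show ?thesis
        using x'(1) c(1) by (intro bexI[of _ x']) (auto simp: field_simps)
    qed
    \<comment> \<open>The bound just shown holds for every \<open>r \<ge> 0\<close>, so the
      threshold \<open>1\<close> is arbitrary.\<close>
    then show ?thesis
      using c(1) by (intro that[of "1 / c" 1]) auto
  next
    case False
    show ?thesis
    proof (cases "P = {}")
      case True
      then show ?thesis by (intro that[of 1 1]) auto
    next
      case nonempty: False
      then obtain x where x: "x \<in> P" by auto
      then obtain x' where x': "x' \<in> P" "\<beta> < a \<bullet> x' \<longrightarrow> (\<forall>y\<in>P. a \<bullet> x' \<le> a \<bullet> y)"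
        using c(2)[of x \<beta>] False by force
      then have "\<beta> < a \<bullet> x'" "\<forall>y\<in>P. a \<bullet> x' \<le> a \<bullet> y"
        using False by auto
      \<comment> \<open>With half the gap as threshold, a point satisfying the premises would lie
        below the minimum \<open>a \<bullet> x'\<close>; the factor \<open>1\<close> is
        arbitrary.\<close>
      then show ?thesis
        by (intro that[of 1 "(a \<bullet> x' - \<beta>) / 2"]) force+
    qed
  qed
qed

text \<open>Constraints are repaired one at a time: \<open>x\<close> moves into the half-space of
  \<open>j\<close>, and the induction hypothesis is applied to \<open>P\<close> cut by that
  half-space, so the repair is never undone. This is why \<open>P\<close> is generalised.\<close>

lemma polyhedron_Int_halfspaces_error_bound:
  fixes P :: "'a::euclidean_space set"
  assumes "finite J" "polyhedron P"
  shows "\<exists>\<kappa>>0. \<exists>\<epsilon>>0. \<forall>x\<in>P. \<forall>r. 0 \<le> r \<longrightarrow> r \<le> \<epsilon> \<longrightarrow> (\<forall>(a, \<beta>)\<in>J. a \<bullet> x \<le> \<beta> + r) \<longrightarrow>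
    (\<exists>x'\<in>P. (\<forall>(a, \<beta>)\<in>J. a \<bullet> x' \<le> \<beta>) \<and> dist x x' \<le> \<kappa> * r)"
  using assms
proof (induction J arbitrary: P rule: finite_induct)
  case empty
  have "\<exists>x'\<in>P. dist x x' \<le> 1 * r" if "x \<in> P" "0 \<le> r" for x and r :: real
    using that by (intro bexI[of _ x]) auto
  then show ?case by (intro exI[of _ "1::real"] conjI) auto
next
  case (insert j J)
  obtain a \<beta> where j: "j = (a, \<beta>)" by force
  obtain \<kappa> \<epsilon> where 1: "\<kappa> > 0" "\<epsilon> > 0"
    "\<And>x r. \<lbrakk>x \<in> P; a \<bullet> x \<le> \<beta> + r; 0 \<le> r; r \<le> \<epsilon>\<rbrakk> \<Longrightarrow> \<exists>x'\<in>P. a \<bullet> x' \<le> \<beta> \<and> dist x x' \<le> \<kappa> * r"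
    using polyhedron_Int_halfspace_error_bound[OF insert.prems, of a \<beta>] by metis
  define P' where "P' = P \<inter> {x. a \<bullet> x \<le> \<beta>}"
  have "polyhedron P'"
    using insert.prems by (simp add: P'_def polyhedron_halfspace_le)
  from insert.IH[OF this] obtain \<kappa>' \<epsilon>' where 2: "\<kappa>' > 0" "\<epsilon>' > 0"
    "\<And>x r. \<lbrakk>x \<in> P'; 0 \<le> r; r \<le> \<epsilon>'; \<forall>(a, \<beta>)\<in>J. a \<bullet> x \<le> \<beta> + r\<rbrakk> \<Longrightarrow>
      \<exists>x'\<in>P'. (\<forall>(a, \<beta>)\<in>J. a \<bullet> x' \<le> \<beta>) \<and> dist x x' \<le> \<kappa>' * r"
    by metis
  \<comment> \<open>A sum instead of a maximum bounds the normals without a special case for empty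
    \<open>J\<close>.\<close>
  define M where "M = (\<Sum>i\<in>J. norm (fst i))"
  have M: "norm (fst i) \<le> M" if "i \<in> J" for i
    unfolding M_def using insert.hyps(1) that by (intro member_le_sum) auto
  have "M \<ge> 0" by (simp add: M_def sum_nonneg)
  \<comment> \<open>Moving by at most \<open>\<kappa> * r\<close> raises each remaining violation
    from \<open>r\<close> to at most \<open>s * r\<close>. The threshold
    \<open>\<epsilon>' / s\<close> below keeps this within reach of the induction
    hypothesis.\<close>
  define s where "s = 1 + M * \<kappa>"
  have s: "s > 0" using \<open>M \<ge> 0\<close> 1(1) by (simp add: s_def add_pos_nonneg)
  have "\<exists>x'\<in>P. (\<forall>(a, \<beta>)\<in>insert j J. a \<bullet> x' \<le> \<beta>) \<and> dist x x' \<le> (\<kappa> + \<kappa>' * s) * r"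
    if x: "x \<in> P" "0 \<le> r" "r \<le> min \<epsilon> (\<epsilon>' / s)" "\<forall>(a, \<beta>)\<in>insert j J. a \<bullet> x \<le> \<beta> + r" for x r
  proof -
    obtain y where y: "y \<in> P" "a \<bullet> y \<le> \<beta>" "dist x y \<le> \<kappa> * r"
      using 1(3)[of x r] x j by auto
    have *: "fst i \<bullet> y \<le> snd i + s * r" if i: "i \<in> J" for i
    proof -
      have "fst i \<bullet> (y - x) \<le> norm (fst i) * norm (y - x)"
        by (rule norm_cauchy_schwarz)
      also have "\<dots> \<le> M * (\<kappa> * r)"
        using M[OF i] y(3) \<open>M \<ge> 0\<close> by (intro mult_mono) (auto simp: dist_norm norm_minus_commute)
      finally have "fst i \<bullet> y \<le> fst i \<bullet> x + M * \<kappa> * r"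
        by (simp add: inner_diff_right)
      moreover have "fst i \<bullet> x \<le> snd i + r"
        using x(4) i by auto
      ultimately show ?thesis by (simp add: s_def algebra_simps)
    qed
    have "\<forall>(a, \<beta>)\<in>J. a \<bullet> y \<le> \<beta> + s * r"
      using * by fastforce
    moreover have "s * r \<le> \<epsilon>'" "0 \<le> s * r"
      using x(2,3) s by (auto simp: field_simps)
    moreover have "y \<in> P'" using y by (simp add: P'_def)
    ultimately obtain x' where x': "x' \<in> P'" "\<forall>(a, \<beta>)\<in>J. a \<bullet> x' \<le> \<beta>" "dist y x' \<le> \<kappa>' * (s * r)"
      using 2(3)[of y "s * r"] by blast
    have "dist x x' \<le> (\<kappa> + \<kappa>' * s) * r"
      using dist_triangle[of x x' y] y(3) x'(3) by (simp add: algebra_simps)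
    then show ?thesis
      using x' j by (intro bexI[of _ x']) (auto simp: P'_def)
  qed
  moreover have "\<kappa> + \<kappa>' * s > 0" "min \<epsilon> (\<epsilon>' / s) > 0"
    using 1 2 s by (auto intro: add_pos_pos)
  ultimately show ?case by metis
qed

text \<open>\<open>L x = 0\<close> is a system of inequalities, two for each coordinate of
  \<open>L x\<close>. Each is violated by at most \<open>norm (L x)\<close>, which serves as
  \<open>r\<close>.\<close>

lemma polyhedron_Int_kernel_error_bound:
  fixes L :: "'a::euclidean_space \<Rightarrow> 'b::euclidean_space"
  assumes "polyhedron P" "linear L"
  shows "\<exists>\<kappa>>0. \<exists>\<epsilon>>0. \<forall>x\<in>P. norm (L x) \<le> \<epsilon> \<longrightarrow>
    (\<exists>x'\<in>P. L x' = 0 \<and> dist x x' \<le> \<kappa> * norm (L x))"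
proof -
  define J where "J = (\<lambda>b. (adjoint L b, 0::real)) ` (Basis \<union> uminus ` Basis)"
  have J: "(\<forall>(a, \<beta>)\<in>J. a \<bullet> x \<le> \<beta> + r) \<longleftrightarrow> (\<forall>b\<in>Basis. \<bar>L x \<bullet> b\<bar> \<le> r)" for x r
    unfolding J_def
    by (auto simp: adjoint_clauses(2)[OF assms(2)] inner_commute[of _ "L x"] abs_le_iff ball_Un)
  have ker: "(\<forall>(a, \<beta>)\<in>J. a \<bullet> x \<le> \<beta>) \<longleftrightarrow> L x = 0" for x
    using J[of x 0] by (auto simp: euclidean_eq_iff[of "L x"])
  have "finite J" by (simp add: J_def)
  from polyhedron_Int_halfspaces_error_bound[OF this assms(1)]
  obtain \<kappa> \<epsilon> where *: "\<kappa> > 0" "\<epsilon> > 0"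
    "\<And>x r. \<lbrakk>x \<in> P; 0 \<le> r; r \<le> \<epsilon>; \<forall>(a, \<beta>)\<in>J. a \<bullet> x \<le> \<beta> + r\<rbrakk> \<Longrightarrow>
      \<exists>x'\<in>P. (\<forall>(a, \<beta>)\<in>J. a \<bullet> x' \<le> \<beta>) \<and> dist x x' \<le> \<kappa> * r"
    by metis
  have "\<exists>x'\<in>P. L x' = 0 \<and> dist x x' \<le> \<kappa> * norm (L x)" if "x \<in> P" "norm (L x) \<le> \<epsilon>" for x
    using *(3)[of x "norm (L x)"] that unfolding J ker by (simp add: Basis_le_norm)
  with *(1,2) show ?thesis by blast
qed

text \<open>The largest factor and the smallest threshold serve all pieces at once;
  \<open>x'\<close> stays in the same piece as \<open>x\<close>.\<close>

lemma polyhedra_Int_kernel_error_bound: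
  fixes L :: "'a::euclidean_space \<Rightarrow> 'b::euclidean_space"
  assumes "finite \<P>" "\<forall>P\<in>\<P>. polyhedron P" "linear L"
  shows "\<exists>\<kappa>>0. \<exists>\<epsilon>>0. \<forall>P\<in>\<P>. \<forall>x\<in>P. norm (L x) \<le> \<epsilon> \<longrightarrow>
    (\<exists>x'\<in>P. L x' = 0 \<and> dist x x' \<le> \<kappa> * norm (L x))"
  using assms(1,2)
proof (induction \<P> rule: finite_induct)
  case empty
  show ?case by (auto intro: exI[of _ 1])
next
  case (insert P \<P>)
  then obtain \<kappa> \<epsilon> where 1: "\<kappa> > 0" "\<epsilon> > 0" "\<forall>P\<in>\<P>. \<forall>x\<in>P. norm (L x) \<le> \<epsilon> \<longrightarrow>
    (\<exists>x'\<in>P. L x' = 0 \<and> dist x x' \<le> \<kappa> * norm (L x))"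
    by auto
  obtain \<kappa>' \<epsilon>' where 2: "\<kappa>' > 0" "\<epsilon>' > 0" "\<forall>x\<in>P. norm (L x) \<le> \<epsilon>' \<longrightarrow>
    (\<exists>x'\<in>P. L x' = 0 \<and> dist x x' \<le> \<kappa>' * norm (L x))"
    using polyhedron_Int_kernel_error_bound[of P L] insert.prems assms(3) by auto
  have "\<kappa> * norm (L x) \<le> max \<kappa> \<kappa>' * norm (L x)" "\<kappa>' * norm (L x) \<le> max \<kappa> \<kappa>' * norm (L x)" for x
    by (auto intro: mult_right_mono)
  then have "\<forall>P\<in>insert P \<P>. \<forall>x\<in>P. norm (L x) \<le> min \<epsilon> \<epsilon>' \<longrightarrow>
    (\<exists>x'\<in>P. L x' = 0 \<and> dist x x' \<le> max \<kappa> \<kappa>' * norm (L x))"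
    using 1(3) 2(3) by (smt (verit) insertE)
  then show ?case
    using 1 2 by (metis min_less_iff_conj less_max_iff_disj)
qed


section \<open>Extended distance\<close>

lemma ext_dist_le: "x \<in> \<Omega> \<Longrightarrow> ext_dist w \<Omega> \<le> ereal (dist w x)"
  unfolding ext_dist_def by (rule INF_lower)

text \<open>Division by \<open>\<zeta>\<close> reduces the claim to the greatest lower bound
  property of the infimum. For empty \<open>\<Omega>\<close> the right-hand side is infinite, as
  \<open>\<zeta> > 0\<close>.\<close>

lemma ext_dist_mult_geI:
  fixes c :: ereal
  assumes "\<zeta> > 0" "\<And>x. x \<in> \<Omega> \<Longrightarrow> c \<le> ereal (\<zeta> * dist w x)"
  shows "c \<le> ereal \<zeta> * ext_dist w \<Omega>"
proof -
  have "c / ereal \<zeta> \<le> ext_dist w \<Omega>"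
    unfolding ext_dist_def
  proof (rule INF_greatest)
    fix x assume "x \<in> \<Omega>"
    from assms(2)[OF this] show "c / ereal \<zeta> \<le> ereal (dist w x)"
      using assms(1) by (cases c) (auto simp: field_simps)
  qed
  then show ?thesis
    using assms(1) by (subst (asm) ereal_divide_le_pos) (auto simp: mult.commute)
qed

section \<open>The lifted graph of \<open>S_map\<close>\<close>

text \<open>For pieces \<open>C\<close> and \<open>D\<close> of the two subdifferential graphs, the
  witnesses \<open>\<xi>\<close>, \<open>u\<close>, \<open>v\<close> are kept as coordinates.
  Membership is then polyhedral and the residual is a linear function of the tuple.\<close>

definition S_lift ::
    "(real^'n \<Rightarrow> real^'m) \<Rightarrow> (real^'n \<Rightarrow> real^'p) \<Rightarrow> 'p set \<Rightarrow>
     ((real^'n) \<times> (real^'n)) set \<Rightarrow> ((real^'m) \<times> (real^'m)) set \<Rightarrow>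
     (((real^'m) \<times> (real^'p)) \<times> (real^'n) \<times> (real^'m) \<times> (real^'p)) set" where
  "S_lift A B T C D = {(w, \<xi>, u, v). snd w \<in> V_inf (- T) \<and>
     (- adjoint (stacked_map A B) w, \<xi>) \<in> C \<and> (fst w, u) \<in> D \<and> v \<in> V_inf T}"

lemma polyhedron_V_inf: "polyhedron (V_inf T)"
  by (intro affine_imp_polyhedron subspace_imp_affine) (auto simp: V_inf_def subspace_def)

lemma linear_stacked_map: "linear A \<Longrightarrow> linear B \<Longrightarrow> linear (stacked_map A B)"
  by (auto simp: linear_iff stacked_map_def)

lemma polyhedron_S_lift:
  assumes "linear A" "linear B" "polyhedron C" "polyhedron D"
  shows "polyhedron (S_lift A B T C D)"
proof -
  let ?Q = "adjoint (stacked_map A B)"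
  have Q: "linear ?Q"
    by (intro adjoint_linear linear_stacked_map assms)
  have "S_lift A B T C D =
      (\<lambda>q. snd (fst q)) -` V_inf (- T) \<inter> (\<lambda>q. (- ?Q (fst q), fst (snd q))) -` C \<inter>
      (\<lambda>q. (fst (fst q), fst (snd (snd q)))) -` D \<inter> (\<lambda>q. snd (snd (snd q))) -` V_inf T"
    by (auto simp: S_lift_def)
  also have "polyhedron \<dots>"
    using assms(3,4) polyhedron_V_inf Q
    by (intro polyhedron_Int polyhedron_linear_vimage) (auto simp: linear_iff)
  finally show ?thesis .
qed

text \<open>A pair in a union of pieces lies in one of them, so each element of \<open>S_map\<close>
  comes from a single lifted polyhedron, to which the kernel bound applies.\<close>

lemma S_map_iff_S_lift:
  assumes "graph_of (subdifferential (fenchel_conjugate f)) = \<Union>\<C>"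
    and "graph_of (subdifferential (fenchel_conjugate g)) = \<Union>\<D>"
  shows "e \<in> S_map f g A B T w \<longleftrightarrow> (\<exists>C\<in>\<C>. \<exists>D\<in>\<D>. \<exists>\<xi> u v.
    (w, \<xi>, u, v) \<in> S_lift A B T C D \<and> - stacked_map A B \<xi> + (u, v) = e)"
proof -
  have "s \<in> subdifferential (fenchel_conjugate f) x \<longleftrightarrow> (\<exists>C\<in>\<C>. (x, s) \<in> C)"
    "s' \<in> subdifferential (fenchel_conjugate g) y \<longleftrightarrow> (\<exists>D\<in>\<D>. (y, s') \<in> D)" for s x s' y
    using assms by (auto simp: graph_of_def set_eq_iff)
  then show ?thesis
    by (auto simp: S_map_def S_lift_def V_inf_def) blast+
qed

section \<open>The error bound for \<open>S_map\<close>\<close>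

theorem proposition10:
  fixes f :: "real^'n \<Rightarrow> ereal"
    and g :: "real^'m \<Rightarrow> ereal"
    and A :: "real^'n \<Rightarrow> real^'m"
    and B :: "real^'n \<Rightarrow> real^'p"
    and T :: "'p set"
  assumes "proper_fun f" "closed_fun f" "convex_fun f"
    and "proper_fun g" "closed_fun g" "convex_fun g"
    and "linear A" "linear B"
    and "polyhedral_multifunction (subdifferential (fenchel_conjugate f))"
    and "polyhedral_multifunction (subdifferential (fenchel_conjugate g))"
  shows "\<forall>\<nu>::real. \<nu> > 0 \<longrightarrow> (\<exists>\<zeta>::real. \<zeta> > 0 \<and>
           (\<forall>w. ext_dist w (multi_inverse (S_map f g A B T) 0) \<le> ereal \<nu> \<longrightarrow>
                ext_dist w (multi_inverse (S_map f g A B T) 0)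
                  \<le> ereal \<zeta> * ext_dist 0 (S_map f g A B T w)))"
proof (intro allI impI)
  fix \<nu> :: real assume \<nu>: "\<nu> > 0"
  let ?Z = "multi_inverse (S_map f g A B T) 0"
  obtain \<C> where \<C>: "finite \<C>" "\<forall>C\<in>\<C>. polyhedron C"
    "graph_of (subdifferential (fenchel_conjugate f)) = \<Union>\<C>"
    using assms(9) unfolding polyhedral_multifunction_def by blast
  obtain \<D> where \<D>: "finite \<D>" "\<forall>D\<in>\<D>. polyhedron D"
    "graph_of (subdifferential (fenchel_conjugate g)) = \<Union>\<D>"
    using assms(10) unfolding polyhedral_multifunction_def by blast
  note S = S_map_iff_S_lift[OF \<C>(3) \<D>(3), of _ A B T]
  define L :: "((real^'m) \<times> (real^'p)) \<times> (real^'n) \<times> (real^'m) \<times> (real^'p) \<Rightarrow> (real^'m) \<times> (real^'p)"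
    where "L q = - stacked_map A B (fst (snd q)) + snd (snd q)" for q
  have "linear L"
    using linear_stacked_map[OF assms(7,8)] unfolding linear_iff L_def by (simp add: algebra_simps)
  moreover have "\<forall>P\<in>(\<lambda>(C, D). S_lift A B T C D) ` (\<C> \<times> \<D>). polyhedron P"
    using \<C>(2) \<D>(2) polyhedron_S_lift[OF assms(7,8)] by auto
  ultimately obtain \<kappa> \<epsilon> where \<kappa>: "\<kappa> > 0" "\<epsilon> > 0"
    "\<forall>P\<in>(\<lambda>(C, D). S_lift A B T C D) ` (\<C> \<times> \<D>). \<forall>q\<in>P. norm (L q) \<le> \<epsilon> \<longrightarrow>
      (\<exists>q'\<in>P. L q' = 0 \<and> dist q q' \<le> \<kappa> * norm (L q))"
    using polyhedra_Int_kernel_error_bound[of "(\<lambda>(C, D). S_lift A B T C D) ` (\<C> \<times> \<D>)" L] \<C>(1) \<D>(1)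
    by auto
  \<comment> \<open>The lifted tuple moves to a zero of \<open>L\<close> in its own piece.
    Projection to the first component does not increase distances and lands in \<open>?Z\<close>,
    which is therefore nonempty whenever such an \<open>e\<close> exists.\<close>
  have near: "ext_dist w ?Z \<le> ereal (\<kappa> * norm e)" if e: "e \<in> S_map f g A B T w" "norm e \<le> \<epsilon>" for w e
  proof -
    obtain C D \<xi> u v where CD: "C \<in> \<C>" "D \<in> \<D>" and q: "(w, \<xi>, u, v) \<in> S_lift A B T C D"
      and eq: "L (w, \<xi>, u, v) = e"
      using e(1) unfolding S by (auto simp: L_def)
    have "\<exists>q'\<in>S_lift A B T C D. L q' = 0 \<and> dist (w, \<xi>, u, v) q' \<le> \<kappa> * norm e"
      using \<kappa>(3) CD q eq e(2) by fastforce
    then obtain w' \<xi>' u' v' where q': "(w', \<xi>', u', v') \<in> S_lift A B T C D"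
      "L (w', \<xi>', u', v') = 0" "dist (w, \<xi>, u, v) (w', \<xi>', u', v') \<le> \<kappa> * norm e"
      by auto
    have "w' \<in> ?Z"
      unfolding multi_inverse_def mem_Collect_eq S
      using q'(1,2) CD by (intro bexI exI conjI) (auto simp: L_def)
    then have "ext_dist w ?Z \<le> ereal (dist w w')"
      by (rule ext_dist_le)
    also have "dist w w' \<le> \<kappa> * norm e"
      using dist_fst_le[of "(w, \<xi>, u, v)" "(w', \<xi>', u', v')"] q'(3) by simp
    finally show ?thesis by simp
  qed
  \<comment> \<open>\<open>\<kappa>\<close> handles residuals of norm at most
    \<open>\<epsilon>\<close>, \<open>\<nu> / \<epsilon>\<close> the larger ones.\<close>
  define \<zeta> where "\<zeta> = max \<kappa> (\<nu> / \<epsilon>)"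
  have "\<zeta> > 0" using \<kappa>(1) by (simp add: \<zeta>_def)
  moreover have "ext_dist w ?Z \<le> ereal \<zeta> * ext_dist 0 (S_map f g A B T w)"
    if w: "ext_dist w ?Z \<le> ereal \<nu>" for w
  proof (rule ext_dist_mult_geI[OF \<open>\<zeta> > 0\<close>])
    fix e assume e: "e \<in> S_map f g A B T w"
    show "ext_dist w ?Z \<le> ereal (\<zeta> * dist 0 e)"
    proof (cases "norm e \<le> \<epsilon>")
      case True
      have "\<kappa> * norm e \<le> \<zeta> * norm e"
        by (intro mult_right_mono) (auto simp: \<zeta>_def)
      then show ?thesis
        using near[OF e True] by (auto intro: order_trans)
    next
      case False
      have "\<nu> = \<nu> / \<epsilon> * \<epsilon>" using \<kappa>(2) by simp
      also have "\<dots> \<le> \<zeta> * norm e"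
        using False \<kappa>(2) \<open>\<zeta> > 0\<close> by (intro mult_mono) (auto simp: \<zeta>_def)
      finally show ?thesis
        using w by (auto intro: order_trans)
    qed
  qed
  ultimately show "\<exists>\<zeta>>0. \<forall>w. ext_dist w ?Z \<le> ereal \<nu> \<longrightarrow>
      ext_dist w ?Z \<le> ereal \<zeta> * ext_dist 0 (S_map f g A B T w)"
    by blast
qed

end
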